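(* Let $G$ be a finite group and let $H$ be a normal subgroup of $G$. Let $M=w(\Gamma(G/H))$. Then $\chi(\Gamma_H(G))=|H|(M-1)+1=w(\Gamma_H(G))$.
   Context: For a finite group $G$ with identity $e$ and a normal subgroup $H$ of $G$, the normal subgroup based power graph $\Gamma_H(G)$ is the simple undirected graph with vertex set $V(\Gamma_H(G))=(G\setminus H)\cup\{e\}$, in which two distinct vertices $x,y$ are adjacent if and only if $xH=y^mH$ or $yH=x^nH$ for some $m,n\in\mathbb{N}$. Here $\mathbb{N}$ denotes the positive integers. For a finite group $K$, the (undirected) power graph $\Gamma(K)$ is the simple graph with vertex set $K$ in which two distinct elements $u,v$ are adjacent if and only if $u=v^m$ or $v=u^m$ for some positive integer $m$. The clique number $w(\Gamma)$ is the maximum size of a clique in $\Gamma$, and the chromatic number $\chi(\Gamma)$ is the smallest number of colours in a proper vertex colouring of $\Gamma$. *)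

theory Defs
  imports "HOL-Algebra.Coset" "HOL-Library.Ramsey"
begin

record 'a ugraph =
  uverts :: "'a set"
  uedges :: "'a set set"

definition simple_graph :: "'a ugraph \<Rightarrow> bool" where
  "simple_graph \<Gamma> \<longleftrightarrow> (\<forall>e \<in> uedges \<Gamma>. e \<subseteq> uverts \<Gamma> \<and> card e = 2)"

(* Only meaningful for graphs with finitely many vertices, because of Max. *)
definition clique_number :: "'a ugraph \<Rightarrow> nat" where
  "clique_number \<Gamma> = Max {card C | C. C \<subseteq> uverts \<Gamma> \<and> clique C (uedges \<Gamma>)}"

definition proper_colouring :: "'a ugraph \<Rightarrow> nat \<Rightarrow> ('a \<Rightarrow> nat) \<Rightarrow> bool" where
  "proper_colouring \<Gamma> k c \<longleftrightarrow>
     c ` uverts \<Gamma> \<subseteq> {..<k} \<and>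
     (\<forall>x \<in> uverts \<Gamma>. \<forall>y \<in> uverts \<Gamma>. {x, y} \<in> uedges \<Gamma> \<longrightarrow> c x \<noteq> c y)"

definition chromatic_number :: "'a ugraph \<Rightarrow> nat" where
  "chromatic_number \<Gamma> = (LEAST k. \<exists>c. proper_colouring \<Gamma> k c)"

definition power_graph :: "('a, 'b) monoid_scheme \<Rightarrow> 'a ugraph" where
  "power_graph K =
     \<lparr> uverts = carrier K,
       uedges = {{u, v} | u v. u \<in> carrier K \<and> v \<in> carrier K \<and> u \<noteq> v \<and>
         ((\<exists>m::nat. m > 0 \<and> u = v [^]\<^bsub>K\<^esub> m) \<or> (\<exists>m::nat. m > 0 \<and> v = u [^]\<^bsub>K\<^esub> m))} \<rparr>"

definition nsb_power_graph_verts :: "('a, 'b) monoid_scheme \<Rightarrow> 'a set \<Rightarrow> 'a set" where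
  "nsb_power_graph_verts G H = (carrier G - H) \<union> {\<one>\<^bsub>G\<^esub>}"

(* The normal subgroup based power graph; x <#\<^bsub>G\<^esub> H is the coset xH. *)
definition nsb_power_graph :: "('a, 'b) monoid_scheme \<Rightarrow> 'a set \<Rightarrow> 'a ugraph" where
  "nsb_power_graph G H =
     \<lparr> uverts = nsb_power_graph_verts G H,
       uedges = {{x, y} | x y.
         x \<in> nsb_power_graph_verts G H \<and> y \<in> nsb_power_graph_verts G H \<and> x \<noteq> y \<and>
         ((\<exists>m::nat. m > 0 \<and> x <#\<^bsub>G\<^esub> H = (y [^]\<^bsub>G\<^esub> m) <#\<^bsub>G\<^esub> H) \<or>
          (\<exists>n::nat. n > 0 \<and> y <#\<^bsub>G\<^esub> H = (x [^]\<^bsub>G\<^esub> n) <#\<^bsub>G\<^esub> H))} \<rparr>"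

lemma simple_graph_power_graph: "simple_graph (power_graph K)"
  by (auto simp: simple_graph_def power_graph_def)

lemma simple_graph_nsb_power_graph: "simple_graph (nsb_power_graph G H)"
  by (auto simp: simple_graph_def nsb_power_graph_def)

end

(* The normal subgroup based power graph is the comparability graph of the preorder "x is a power
   of y modulo H", and a finite comparability graph is coloured optimally by the heights of its
   vertices. Its clique number is read off the projection to G/H: each non-identity element of a
   clique of G/H can be replaced by its full coset, whereas of the coset H only the identity
   remains, and it is adjacent to everything. *)
theory Submission
  imports Defs "HOL-Algebra.Multiplicative_Group"
begin

section \<open>Clique number and chromatic number of comparability graphs\<close>

lemma finite_clique_cards:
  assumes "finite (uverts \<Gamma>)"
  shows "finite {card C | C. C \<subseteq> uverts \<Gamma> \<and> clique C (uedges \<Gamma>)}"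
proof (rule finite_subset)
  show "{card C | C. C \<subseteq> uverts \<Gamma> \<and> clique C (uedges \<Gamma>)} \<subseteq> card ` Pow (uverts \<Gamma>)"
    by auto
qed (use assms in simp)

lemma card_clique_le_clique_number:
  assumes "finite (uverts \<Gamma>)" "C \<subseteq> uverts \<Gamma>" "clique C (uedges \<Gamma>)"
  shows "card C \<le> clique_number \<Gamma>"
  unfolding clique_number_def
  by (rule Max_ge[OF finite_clique_cards]) (use assms in auto)

lemma maximum_clique_exists:
  assumes "finite (uverts \<Gamma>)"
  obtains C where "C \<subseteq> uverts \<Gamma>" "clique C (uedges \<Gamma>)" "card C = clique_number \<Gamma>"
proof -
  \<comment> \<open>The empty clique keeps the set under \<open>Max\<close> nonempty, so
    \<open>Max\<close> is attained.\<close>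
  have "clique {} (uedges \<Gamma>)"
    by (simp add: clique_def)
  then have "{card C | C. C \<subseteq> uverts \<Gamma> \<and> clique C (uedges \<Gamma>)} \<noteq> {}"
    by blast
  from Max_in[OF finite_clique_cards[OF assms] this] show ?thesis
    unfolding clique_number_def[symmetric] using that by auto
qed

lemma clique_number_le_colours:
  assumes "finite (uverts \<Gamma>)" "proper_colouring \<Gamma> k c"
  shows "clique_number \<Gamma> \<le> k"
proof -
  obtain C where C: "C \<subseteq> uverts \<Gamma>" "clique C (uedges \<Gamma>)" "card C = clique_number \<Gamma>"
    using maximum_clique_exists[OF assms(1)] .
  have "inj_on c C"
    using C(1,2) assms(2) unfolding inj_on_def clique_def proper_colouring_def by blast
  moreover have "c ` C \<subseteq> {..<k}"
    using C(1) assms(2) unfolding proper_colouring_def by blast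
  ultimately have "card C \<le> card {..<k}"
    by (intro card_inj_on_le) auto
  then show ?thesis
    using C(3) by simp
qed

lemma chromatic_number_eqI:
  assumes "finite (uverts \<Gamma>)" "proper_colouring \<Gamma> (clique_number \<Gamma>) c"
  shows "chromatic_number \<Gamma> = clique_number \<Gamma>"
  unfolding chromatic_number_def
  using assms clique_number_le_colours by (intro Least_equality) auto

text \<open>Colour each vertex x by its height \<open>h x\<close>, the size of a largest clique
  among the vertices strictly below x. Heights strictly increase along \<open>L\<close>, so adjacent
  vertices get different colours, and they stay below the clique number.\<close>

lemma chromatic_number_strict_order:
  assumes fin: "finite (uverts \<Gamma>)"
    and edges: "\<And>x y. \<lbrakk>x \<in> uverts \<Gamma>; y \<in> uverts \<Gamma>\<rbrakk> \<Longrightarrow> {x, y} \<in> uedges \<Gamma> \<longleftrightarrow> L x y \<or> L y x"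
    and irrefl: "\<And>x. x \<in> uverts \<Gamma> \<Longrightarrow> \<not> L x x"
    and trans: "\<And>x y z. \<lbrakk>x \<in> uverts \<Gamma>; y \<in> uverts \<Gamma>; z \<in> uverts \<Gamma>; L x y; L y z\<rbrakk> \<Longrightarrow> L x z"
  shows "chromatic_number \<Gamma> = clique_number \<Gamma>"
proof -
  \<comment> \<open>All edges of the graph may be kept, since \<open>clique_number\<close> only
    considers cliques inside the restricted vertex set.\<close>
  define below where "below x = \<lparr>uverts = {y \<in> uverts \<Gamma>. L y x}, uedges = uedges \<Gamma>\<rparr>" for x
  define h where "h x = clique_number (below x)" for x
  have fin_below: "finite (uverts (below x))" for x
    using fin by (simp add: below_def)
  \<comment> \<open>A largest clique below x can be topped by x itself. This extra element gives
    both the strict increase of \<open>h\<close> and the strict bound on it.\<close>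
  have ext: "\<exists>D. D \<subseteq> insert x (uverts (below x)) \<and> clique D (uedges \<Gamma>) \<and> card D = Suc (h x)"
    if x: "x \<in> uverts \<Gamma>" for x
  proof -
    obtain C where C: "C \<subseteq> uverts (below x)" "clique C (uedges \<Gamma>)" "card C = h x"
      using maximum_clique_exists[OF fin_below, of x] by (auto simp: h_def below_def)
    have Cx: "y \<in> uverts \<Gamma>" "L y x" if "y \<in> C" for y
      using C(1) that by (auto simp: below_def)
    have "x \<notin> C"
      using Cx(2) irrefl x by blast
    moreover have "finite C"
      using C(1) fin_below finite_subset by blast
    moreover have "clique (insert x C) (uedges \<Gamma>)"
      using C(2) Cx edges x unfolding clique_def by (metis insert_iff)
    ultimately show ?thesis
      using C by (intro exI[of _ "insert x C"]) auto
  qed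
  have mono: "h x < h y" if xy: "x \<in> uverts \<Gamma>" "y \<in> uverts \<Gamma>" "L x y" for x y
  proof -
    obtain D where D: "D \<subseteq> insert x (uverts (below x))" "clique D (uedges \<Gamma>)" "card D = Suc (h x)"
      using ext xy(1) by blast
    have "insert x (uverts (below x)) \<subseteq> uverts (below y)"
      using xy trans[of _ x y] unfolding below_def by auto
    with D have "card D \<le> h y"
      unfolding h_def
      by (intro card_clique_le_clique_number[OF fin_below]) (auto simp: below_def)
    then show ?thesis
      using D(3) by simp
  qed
  have "h x < clique_number \<Gamma>" if x: "x \<in> uverts \<Gamma>" for x
  proof -
    obtain D where D: "D \<subseteq> insert x (uverts (below x))" "clique D (uedges \<Gamma>)" "card D = Suc (h x)"
      using ext x by blast
    then have "card D \<le> clique_number \<Gamma>"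
      using x by (intro card_clique_le_clique_number[OF fin]) (auto simp: below_def)
    then show ?thesis
      using D(3) by simp
  qed
  moreover have "h x \<noteq> h y" if "x \<in> uverts \<Gamma>" "y \<in> uverts \<Gamma>" "{x, y} \<in> uedges \<Gamma>" for x y
    using mono edges that by (metis less_irrefl)
  ultimately have "proper_colouring \<Gamma> (clique_number \<Gamma>) h"
    unfolding proper_colouring_def by auto
  then show ?thesis
    by (rule chromatic_number_eqI[OF fin])
qed

text \<open>The strict part of \<open>R\<close> would lose the edges between distinct vertices
  related both ways, so \<open>R\<close> is refined to a strict order with the same comparability
  graph.\<close>

lemma chromatic_number_comparability_graph:
  assumes fin: "finite (uverts \<Gamma>)"
    and edges: "\<And>x y. \<lbrakk>x \<in> uverts \<Gamma>; y \<in> uverts \<Gamma>\<rbrakk> \<Longrightarrow>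
                  {x, y} \<in> uedges \<Gamma> \<longleftrightarrow> x \<noteq> y \<and> (R x y \<or> R y x)"
    and trans: "\<And>x y z. \<lbrakk>x \<in> uverts \<Gamma>; y \<in> uverts \<Gamma>; z \<in> uverts \<Gamma>; R x y; R y z\<rbrakk> \<Longrightarrow> R x z"
  shows "chromatic_number \<Gamma> = clique_number \<Gamma>"
proof -
  obtain f :: "'a \<Rightarrow> nat" where f: "inj_on f (uverts \<Gamma>)"
    using finite_imp_inj_to_nat_seg[OF fin] by blast
  \<comment> \<open>An enumeration breaks the ties of the preorder without changing comparability.\<close>
  define L where "L x y \<longleftrightarrow> R x y \<and> (R y x \<longrightarrow> f x < f y)" for x y
  show ?thesis
  proof (rule chromatic_number_strict_order[OF fin])
    show "{x, y} \<in> uedges \<Gamma> \<longleftrightarrow> L x y \<or> L y x" if "x \<in> uverts \<Gamma>" "y \<in> uverts \<Gamma>" for x y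
      using edges[OF that] inj_on_eq_iff[OF f that] unfolding L_def by auto
    show "\<not> L x x" for x
      by (simp add: L_def)
    \<comment> \<open>If also \<open>R z x\<close>, then x, y and z are all related both ways, and
      the inequalities for \<open>f\<close> chain.\<close>
    show "L x z" if "x \<in> uverts \<Gamma>" "y \<in> uverts \<Gamma>" "z \<in> uverts \<Gamma>" "L x y" "L y z" for x y z
      using that trans unfolding L_def by (meson less_trans)
  qed
qed

section \<open>Power graphs modulo a normal subgroup\<close>

lemma uverts_power_graph [simp]: "uverts (power_graph K) = carrier K"
  by (simp add: power_graph_def)

lemma uverts_nsb_power_graph [simp]:
  "uverts (nsb_power_graph G H) = nsb_power_graph_verts G H"
  by (simp add: nsb_power_graph_def)

text \<open>An unordered pair can enter the comprehension in either order; symmetry of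
  \<open>P\<close> makes the order irrelevant.\<close>

lemma doubleton_mem_symmetric_iff:
  assumes "\<And>x y. P x y \<Longrightarrow> P y x"
  shows "{u, v} \<in> {{x, y} | x y. P x y} \<longleftrightarrow> P u v"
proof
  assume "{u, v} \<in> {{x, y} | x y. P x y}"
  then obtain x y where "{u, v} = {x, y}" "P x y"
    by blast
  then show "P u v"
    using assms by (metis doubleton_eq_iff)
qed blast

lemma power_graph_edge_iff:
  assumes "u \<in> carrier K" "v \<in> carrier K"
  shows "{u, v} \<in> uedges (power_graph K) \<longleftrightarrow> u \<noteq> v \<and>
    ((\<exists>m::nat. m > 0 \<and> u = v [^]\<^bsub>K\<^esub> m) \<or> (\<exists>m::nat. m > 0 \<and> v = u [^]\<^bsub>K\<^esub> m))"
  unfolding power_graph_def ugraph.simps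
  by (subst doubleton_mem_symmetric_iff) (use assms in auto)

lemma nsb_power_graph_edge_iff:
  assumes "x \<in> nsb_power_graph_verts G H" "y \<in> nsb_power_graph_verts G H"
  shows "{x, y} \<in> uedges (nsb_power_graph G H) \<longleftrightarrow> x \<noteq> y \<and>
    ((\<exists>m::nat. m > 0 \<and> x <#\<^bsub>G\<^esub> H = (y [^]\<^bsub>G\<^esub> m) <#\<^bsub>G\<^esub> H) \<or>
     (\<exists>m::nat. m > 0 \<and> y <#\<^bsub>G\<^esub> H = (x [^]\<^bsub>G\<^esub> m) <#\<^bsub>G\<^esub> H))"
  unfolding nsb_power_graph_def ugraph.simps
  by (subst doubleton_mem_symmetric_iff) (use assms in auto)

lemma (in group) power_graph_one_adjacent:
  assumes "finite (carrier G)" "u \<in> carrier G" "u \<noteq> \<one>"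
  shows "{\<one>, u} \<in> uedges (power_graph G)"
proof -
  \<comment> \<open>Exponents must be positive, so the group order serves in place of 0.\<close>
  have "order G > 0" "\<one> = u [^] order G"
    using assms order_gt_0_iff_finite pow_order_eq_1 by auto
  then show ?thesis
    using assms by (auto simp: power_graph_edge_iff)
qed

text \<open>This allows a maximum clique to be chosen with the identity in it, and a clique without
  the identity to be enlarged; the M - 1 in the formula comes from here.\<close>

lemma (in group) clique_insert_one:
  assumes "finite (carrier G)" "C \<subseteq> carrier G" "clique C (uedges (power_graph G))"
  shows "clique (insert \<one> C) (uedges (power_graph G))"
  unfolding clique_def
proof (intro ballI impI)
  fix u v assume uv: "u \<in> insert \<one> C" "v \<in> insert \<one> C" "u \<noteq> v"
  consider "u = \<one>" | "v = \<one>" | "u \<in> C" "v \<in> C"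
    using uv by blast
  then show "{u, v} \<in> uedges (power_graph G)"
  proof cases
    case 1
    then show ?thesis using uv assms(2) power_graph_one_adjacent[OF assms(1), of v] by auto
  next
    case 2
    then show ?thesis
      using uv assms(2) power_graph_one_adjacent[OF assms(1), of u] by (auto simp: insert_commute)
  next
    case 3
    then show ?thesis using assms(3) uv(3) by (simp add: clique_def)
  qed
qed

section \<open>Cosets as elements of the quotient group\<close>

context normal
begin

lemma l_coset_carrier_FactGroup: "x \<in> carrier G \<Longrightarrow> x <# H \<in> carrier (G Mod H)"
  using coset_eq by (auto simp: FactGroup_def RCOSETS_def)

text \<open>The canonical projection is a homomorphism given by right cosets; by normality these
  agree with the left cosets that define the graph.\<close>

lemma l_coset_nat_pow:
  fixes n :: nat
  assumes "x \<in> carrier G"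
  shows "(x [^] n) <# H = (x <# H) [^]\<^bsub>G Mod H\<^esub> n"
proof -
  interpret group_hom G "G Mod H" "\<lambda>a. H #> a"
    using factorgroup_is_group r_coset_hom_Mod is_group by (simp add: group_hom_def group_hom_axioms_def)
  show ?thesis
    using assms coset_eq hom_nat_pow by simp
qed

lemma l_coset_eq_one_iff:
  assumes "x \<in> carrier G"
  shows "x <# H = \<one>\<^bsub>G Mod H\<^esub> \<longleftrightarrow> x \<in> H"
proof -
  have "x <# H = H #> x"
    using assms coset_eq by simp
  then show ?thesis
    using assms coset_join1[OF _ _ is_subgroup] coset_join2[OF _ is_subgroup]
    by (auto simp: FactGroup_def)
qed

lemma l_coset_eq_iff_mem:
  assumes "x \<in> carrier G" "u \<in> carrier (G Mod H)"
  shows "x <# H = u \<longleftrightarrow> x \<in> u"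
proof -
  obtain a where a: "a \<in> carrier G" "u = H #> a"
    using assms(2) by (auto simp: FactGroup_def RCOSETS_def)
  have "H #> x = H #> a \<longleftrightarrow> x \<in> H #> a"
    using assms a is_subgroup repr_independence rcos_self by metis
  then show ?thesis
    using a coset_eq assms(1) by simp
qed

lemma FactGroup_elem_subset: "u \<in> carrier (G Mod H) \<Longrightarrow> u \<subseteq> carrier G"
  using r_coset_subset_G[OF subset] by (auto simp: FactGroup_def RCOSETS_def)

lemma card_FactGroup_elem:
  assumes "u \<in> carrier (G Mod H)"
  shows "card u = card H"
  using card_rcosets_equal[of u H] assms subset by (simp add: FactGroup_def)

lemma nsb_verts_carrier: "nsb_power_graph_verts G H \<subseteq> carrier G"
  by (auto simp: nsb_power_graph_verts_def)

text \<open>The graph is a blow-up of the power graph of the quotient: each coset becomes a clique,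
  and adjacent cosets are completely joined.\<close>

lemma nsb_power_graph_edge_iff_quotient:
  assumes "x \<in> nsb_power_graph_verts G H" "y \<in> nsb_power_graph_verts G H"
  shows "{x, y} \<in> uedges (nsb_power_graph G H) \<longleftrightarrow> x \<noteq> y \<and>
    (x <# H = y <# H \<or> {x <# H, y <# H} \<in> uedges (power_graph (G Mod H)))"
proof -
  interpret Q: group "G Mod H"
    by (rule factorgroup_is_group)
  have xy: "x \<in> carrier G" "y \<in> carrier G"
    using assms nsb_verts_carrier by auto
  \<comment> \<open>Exponent 1 makes two vertices in the same coset adjacent.\<close>
  have "\<exists>m::nat. m > 0 \<and> u = u [^]\<^bsub>G Mod H\<^esub> m" if "u \<in> carrier (G Mod H)" for u
    using that Q.nat_pow_eone by (metis zero_less_one)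
  note refl_pow = this[OF l_coset_carrier_FactGroup]
  show ?thesis
    unfolding nsb_power_graph_edge_iff[OF assms] l_coset_nat_pow[OF xy(1)] l_coset_nat_pow[OF xy(2)]
      power_graph_edge_iff[OF l_coset_carrier_FactGroup[OF xy(1)] l_coset_carrier_FactGroup[OF xy(2)]]
    using refl_pow[OF xy(2)] by metis
qed

section \<open>Chromatic number and clique number of the normal subgroup based power graph\<close>

lemma chromatic_number_nsb_power_graph:
  assumes "finite (carrier G)"
  shows "chromatic_number (nsb_power_graph G H) = clique_number (nsb_power_graph G H)"
proof -
  interpret Q: group "G Mod H"
    by (rule factorgroup_is_group)
  define R where "R x y \<longleftrightarrow> (\<exists>m::nat. m > 0 \<and> x <# H = (y [^] m) <# H)" for x y
  have trans: "R x z" if yz: "y \<in> carrier G" "z \<in> carrier G" and R: "R x y" "R y z" for x y z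
  proof -
    obtain m n :: nat where "m > 0" "n > 0" "x <# H = (y [^] m) <# H" "y <# H = (z [^] n) <# H"
      using R unfolding R_def by blast
    \<comment> \<open>In the quotient, xH is the m-th power of yH, which is the n-th power of zH, so
      the exponents multiply.\<close>
    then have "n * m > 0 \<and> x <# H = (z [^] (n * m)) <# H"
      using yz l_coset_nat_pow l_coset_carrier_FactGroup Q.nat_pow_pow by (metis nat_0_less_mult_iff)
    then show ?thesis
      unfolding R_def by blast
  qed
  show ?thesis
  proof (rule chromatic_number_comparability_graph)
    show "finite (uverts (nsb_power_graph G H))"
      using finite_subset[OF nsb_verts_carrier assms] by simp
    show "{x, y} \<in> uedges (nsb_power_graph G H) \<longleftrightarrow> x \<noteq> y \<and> (R x y \<or> R y x)"
      if "x \<in> uverts (nsb_power_graph G H)" "y \<in> uverts (nsb_power_graph G H)" for x y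
      using that unfolding uverts_nsb_power_graph R_def by (rule nsb_power_graph_edge_iff)
    show "R x z"
      if "x \<in> uverts (nsb_power_graph G H)" "y \<in> uverts (nsb_power_graph G H)"
        "z \<in> uverts (nsb_power_graph G H)" "R x y" "R y z" for x y z
      using that trans nsb_verts_carrier unfolding uverts_nsb_power_graph by blast
  qed
qed

text \<open>Apart from the identity, a clique lies over a clique of the quotient that avoids the
  identity coset, and each fibre has at most |H| elements.\<close>

lemma card_nsb_clique_le:
  assumes fin: "finite (carrier G)"
    and C: "C \<subseteq> nsb_power_graph_verts G H" "clique C (uedges (nsb_power_graph G H))"
  shows "card C \<le> card H * (clique_number (power_graph (G Mod H)) - 1) + 1"
proof -
  interpret Q: group "G Mod H"
    by (rule factorgroup_is_group)
  have finQ: "finite (carrier (G Mod H))"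
    using fin by (simp add: FactGroup_def RCOSETS_def)
  define C' where "C' = C - {\<one>}"
  define D where "D = (\<lambda>x. x <# H) ` C'"
  have C': "C' \<subseteq> carrier G - H"
    using C(1) by (auto simp: C'_def nsb_power_graph_verts_def)
  have finC': "finite C'"
    using C' fin finite_subset by blast
  have D: "D \<subseteq> carrier (G Mod H)" "\<one>\<^bsub>G Mod H\<^esub> \<notin> D"
    using C' l_coset_carrier_FactGroup l_coset_eq_one_iff unfolding D_def by auto
  have "clique D (uedges (power_graph (G Mod H)))"
    unfolding clique_def D_def
  proof (clarify)
    fix x y assume "x \<in> C'" "y \<in> C'" and ne: "x <# H \<noteq> y <# H"
    then have xy: "x \<in> C" "y \<in> C" "x \<noteq> y"
      by (auto simp: C'_def)
    then have "{x, y} \<in> uedges (nsb_power_graph G H)"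
      using C(2) by (simp add: clique_def)
    then show "{x <# H, y <# H} \<in> uedges (power_graph (G Mod H))"
      using ne nsb_power_graph_edge_iff_quotient[OF subsetD[OF C(1) xy(1)] subsetD[OF C(1) xy(2)]]
      by simp
  qed
  \<comment> \<open>Since \<open>D\<close> misses the identity coset, adjoining it yields a strictly
    larger clique; this bounds \<open>card D\<close> by M - 1 instead of M.\<close>
  then have "clique (insert \<one>\<^bsub>G Mod H\<^esub> D) (uedges (power_graph (G Mod H)))"
    by (rule Q.clique_insert_one[OF finQ D(1)])
  then have "card (insert \<one>\<^bsub>G Mod H\<^esub> D) \<le> clique_number (power_graph (G Mod H))"
    using D(1) finQ Q.one_closed by (intro card_clique_le_clique_number) simp_all
  then have cardD: "card D \<le> clique_number (power_graph (G Mod H)) - 1"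
    using D finQ finite_subset by fastforce
  have "C' \<subseteq> \<Union>D"
  proof
    fix x assume x: "x \<in> C'"
    then have "x \<in> carrier G"
      using C' by blast
    then have "x \<in> x <# H"
      using l_coset_eq_iff_mem l_coset_carrier_FactGroup by metis
    then show "x \<in> \<Union>D"
      using x by (auto simp: D_def)
  qed
  moreover have "finite (\<Union>D)"
    using finite_subset[OF _ fin] D(1) FactGroup_elem_subset by (meson Sup_least subsetD)
  ultimately have "card C' \<le> card (\<Union>D)"
    by (intro card_mono)
  also have "\<dots> \<le> (\<Sum>u\<in>D. card u)"
    by (rule card_Union_le_sum_card)
  also have "\<dots> = card H * card D"
    using D(1) card_FactGroup_elem by (subst sum.cong[OF refl, of _ _ "\<lambda>_. card H"]) auto
  also have "\<dots> \<le> card H * (clique_number (power_graph (G Mod H)) - 1)"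
    using cardD by simp
  finally have "card C' \<le> card H * (clique_number (power_graph (G Mod H)) - 1)" .
  moreover have "card C \<le> card C' + 1"
    by (cases "\<one> \<in> C") (auto simp: C'_def card_Diff_singleton)
  ultimately show ?thesis
    by linarith
qed

text \<open>The clique consists of the identity and all elements of the M - 1 nontrivial cosets in a
  maximum clique of the quotient that contains the identity coset.\<close>

lemma nsb_clique_exists:
  assumes fin: "finite (carrier G)"
  obtains C where "C \<subseteq> nsb_power_graph_verts G H" "clique C (uedges (nsb_power_graph G H))"
    "card C = card H * (clique_number (power_graph (G Mod H)) - 1) + 1"
proof -
  interpret Q: group "G Mod H"
    by (rule factorgroup_is_group)
  have finQ: "finite (carrier (G Mod H))"
    using fin by (simp add: FactGroup_def RCOSETS_def)
  obtain D where D: "D \<subseteq> carrier (G Mod H)" "clique D (uedges (power_graph (G Mod H)))"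
    "card D = clique_number (power_graph (G Mod H))"
    using maximum_clique_exists[of "power_graph (G Mod H)"] finQ
    unfolding uverts_power_graph by blast
  define D' where "D' = insert \<one>\<^bsub>G Mod H\<^esub> D"
  have D': "D' \<subseteq> carrier (G Mod H)" "clique D' (uedges (power_graph (G Mod H)))"
    using D(1) Q.one_closed Q.clique_insert_one[OF finQ D(1,2)] unfolding D'_def by blast+
  have finD': "finite D'"
    using D'(1) finQ finite_subset by blast
  \<comment> \<open>By maximality of \<open>D\<close>, adjoining the identity coset cannot increase
    the size.\<close>
  have "card D' \<le> clique_number (power_graph (G Mod H))"
    using D' finQ by (intro card_clique_le_clique_number) simp_all
  moreover have "card D \<le> card D'"
    using finD' by (intro card_mono) (auto simp: D'_def)
  ultimately have cardD': "card D' = clique_number (power_graph (G Mod H))"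
    using D(3) by simp
  define E where "E = D' - {\<one>\<^bsub>G Mod H\<^esub>}"
  have E: "E \<subseteq> carrier (G Mod H)" "\<one>\<^bsub>G Mod H\<^esub> \<notin> E"
    using D'(1) by (auto simp: E_def)
  have cardE: "card E = clique_number (power_graph (G Mod H)) - 1"
    unfolding E_def cardD'[symmetric] by (rule card_Diff_singleton) (simp add: D'_def)
  define C where "C = insert \<one> (\<Union>E)"
  have UE: "x \<in> carrier G \<and> x <# H \<in> E" if "x \<in> \<Union>E" for x
  proof -
    obtain u where u: "u \<in> E" "x \<in> u"
      using \<open>x \<in> \<Union>E\<close> by blast
    then have "u \<in> carrier (G Mod H)"
      using E(1) by blast
    moreover from this have "x \<in> carrier G"
      using u(2) FactGroup_elem_subset by blast
    moreover from calculation have "x <# H = u"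
      using u(2) l_coset_eq_iff_mem by simp
    ultimately show ?thesis
      using u(1) by simp
  qed
  have UE_H: "x \<notin> H" if "x \<in> \<Union>E" for x
  proof -
    have "x <# H \<noteq> \<one>\<^bsub>G Mod H\<^esub>"
      using UE[OF that] E(2) by auto
    then show ?thesis
      using l_coset_eq_one_iff UE[OF that] by simp
  qed
  have sub: "C \<subseteq> nsb_power_graph_verts G H"
    unfolding C_def nsb_power_graph_verts_def using UE UE_H by blast
  \<comment> \<open>The identity projects to the identity coset, which is in \<open>D'\<close> but
    not in \<open>E\<close>; hence adjacency is checked in \<open>D'\<close>.\<close>
  have inD': "x <# H \<in> D'" if x: "x \<in> C" for x
  proof (cases "x = \<one>")
    case True
    then show ?thesis
      using l_coset_eq_one_iff[of \<one>] subgroup.one_closed[OF is_subgroup] by (simp add: D'_def)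
  next
    case False
    then have "x \<in> \<Union>E"
      using x unfolding C_def by blast
    then show ?thesis
      using UE unfolding E_def by blast
  qed
  have "clique C (uedges (nsb_power_graph G H))"
    unfolding clique_def
  proof (intro ballI impI)
    fix x y assume xy: "x \<in> C" "y \<in> C" "x \<noteq> y"
    show "{x, y} \<in> uedges (nsb_power_graph G H)"
      unfolding nsb_power_graph_edge_iff_quotient[OF subsetD[OF sub xy(1)] subsetD[OF sub xy(2)]]
      using xy(3) inD'[OF xy(1)] inD'[OF xy(2)] D'(2) by (auto simp: clique_def)
  qed
  moreover have "card C = card H * card E + 1"
  proof -
    have "finite E"
      using E(1) finQ finite_subset by blast
    moreover have "finite u" if "u \<in> E" for u
      using that E(1) FactGroup_elem_subset finite_subset[OF _ fin] by blast
    \<comment> \<open>Distinct cosets are disjoint, so their cardinalities add up exactly.\<close>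
    moreover have "pairwise disjnt E"
      using pairwise_subset[OF rcos_disjoint[OF is_subgroup]] E(1) by (simp add: FactGroup_def)
    ultimately have "card (\<Union>E) = (\<Sum>u\<in>E. card u)" "finite (\<Union>E)"
      by (simp_all add: card_Union_disjoint)
    moreover have "(\<Sum>u\<in>E. card u) = card H * card E"
      using E(1) card_FactGroup_elem by (subst sum.cong[OF refl, of _ _ "\<lambda>_. card H"]) auto
    moreover have "\<one> \<notin> \<Union>E"
      using UE_H subgroup.one_closed[OF is_subgroup] by blast
    ultimately show ?thesis
      by (simp add: C_def)
  qed
  ultimately show ?thesis
    using that sub cardE by simp
qed

lemma clique_number_nsb_power_graph:
  assumes fin: "finite (carrier G)"
  shows "clique_number (nsb_power_graph G H) =
    card H * (clique_number (power_graph (G Mod H)) - 1) + 1"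
proof (rule antisym)
  have finV: "finite (uverts (nsb_power_graph G H))"
    using finite_subset[OF nsb_verts_carrier fin] by simp
  show "clique_number (nsb_power_graph G H) \<le>
      card H * (clique_number (power_graph (G Mod H)) - 1) + 1"
    using maximum_clique_exists[OF finV] card_nsb_clique_le[OF fin] by (metis uverts_nsb_power_graph)
  show "card H * (clique_number (power_graph (G Mod H)) - 1) + 1 \<le>
      clique_number (nsb_power_graph G H)"
    using nsb_clique_exists[OF fin] card_clique_le_clique_number[OF finV] by (metis uverts_nsb_power_graph)
qed

end

text \<open>The singleton of the identity is a clique. Positivity makes the truncated subtraction in
  the clique formula agree with the integer M - 1.\<close>

lemma (in group) clique_number_power_graph_pos:
  assumes "finite (carrier G)"
  shows "clique_number (power_graph G) \<ge> 1"
  using card_clique_le_clique_number[of "power_graph G" "{\<one>}"] assms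
  by (simp add: clique_def)

theorem corollary6p6:
  fixes G :: "('a, 'b) monoid_scheme" and H :: "'a set" and M :: nat
  assumes "group G" and "finite (carrier G)" and "H \<lhd> G"
    and "M = clique_number (power_graph (G Mod H))"
  shows "int (chromatic_number (nsb_power_graph G H)) = int (card H) * (int M - 1) + 1
    \<and> int (card H) * (int M - 1) + 1 = int (clique_number (nsb_power_graph G H))"
proof -
  interpret normal H G
    by (rule assms(3))
  have "finite (carrier (G Mod H))"
    using assms(2) by (simp add: FactGroup_def RCOSETS_def)
  then have "M \<ge> 1"
    using group.clique_number_power_graph_pos[OF factorgroup_is_group] assms(4) by simp
  then show ?thesis
    using clique_number_nsb_power_graph[OF assms(2)] chromatic_number_nsb_power_graph[OF assms(2)]
      assms(4) by (simp add: of_nat_diff)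
qed

end
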